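(* Let $n\ge 1$, $\pi\in(0,1)$, let $y_i:\{0,1\}^n\to\mathbb{R}$ ($i\in[n]$) be potential outcome functions and let $d_i:\{0,1\}^n\to\mathcal{D}_i$ ($i\in[n]$) be arbitrary exposure mappings. Let $\tau_{\mathrm{MPE}}(\pi)$, $\tau_{\mathrm{ADE}}(\pi)$, $\tau_{\mathrm{AIE}}(\pi)$ be the exposure-based (pseudo-true) marginal policy effect, average direct effect and average indirect effect defined in the context. Then, under the Bernoulli design $\mathrm{RCT}(\pi)$, $$\tau_{\mathrm{MPE}}(\pi)=\tau_{\mathrm{ADE}}(\pi)+\tau_{\mathrm{AIE}}(\pi).$$
   Context: Units are indexed by $[n]=\{1,\dots,n\}$. $\mathbf{W}=(W_1,\dots,W_n)\sim\mathrm{RCT}(\pi)$ means that the $W_i$ are independent with $\mathbb{P}(W_i=1)=1-\mathbb{P}(W_i=0)=\pi$. The outcome functions $y_i$ are held fixed; all expectations are over the assignment vectors. For a function $f$ on $\{0,1\}^n$, $f(w_i=t,\mathbf{W}_{-i})$ is its value at the vector whose $i$-th coordinate is $t$ and whose other coordinates are those of $\mathbf{W}$. Pseudo-true outcome model: for $d$ in the range of $d_i$, $$h_i^*(d;\pi)=\mathbb{E}_{\mathbf{W}\sim\mathrm{RCT}(\pi)}[y_i(\mathbf{W})\mid d_i(\mathbf{W})=d],\qquad \tilde y_i(\mathbf{w};\pi)=h_i^*(d_i(\mathbf{w});\pi),\ \mathbf{w}\in\{0,1\}^n.$$ Marginal policy effect: for $\pi_1,\pi_2\in(0,1)$ put $$\mu(\pi_1,\pi_2)=\frac1n\sum_{i=1}^n\mathbb{E}_{\mathbf{W}^{(1)}\sim\mathrm{RCT}(\pi_1)}\big[h_i^*(d_i(\mathbf{W}^{(1)});\pi_2)\big],\qquad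 \tau_{\mathrm{MPE}}(\pi)=\frac{\partial}{\partial\pi_1}\mu(\pi_1,\pi_2)\Big|_{\pi_1=\pi_2=\pi}.$$ Direct and indirect effects: $$\tau_{\mathrm{ADE}}(\pi)=\frac1n\sum_{i=1}^n\mathbb{E}_{\mathbf{W}\sim\mathrm{RCT}(\pi)}\big[\tilde y_i(w_i=1,\mathbf{W}_{-i};\pi)-\tilde y_i(w_i=0,\mathbf{W}_{-i};\pi)\big],$$ $$\tau_{\mathrm{AIE}}(\pi)=\frac1n\sum_{j=1}^n\sum_{i\ne j}\mathbb{E}_{\mathbf{W}\sim\mathrm{RCT}(\pi)}\big[\tilde y_j(w_i=1,\mathbf{W}_{-i};\pi)-\tilde y_j(w_i=0,\mathbf{W}_{-i};\pi)\big].$$ *)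

theory Defs
  imports "HOL-Probability.Probability"
begin

text \<open>
  Units are the numbers in \<open>{1..n}\<close>. An assignment vector in \<open>{0,1}^n\<close> is a function
  \<open>w :: nat \<Rightarrow> bool\<close> (\<open>True\<close> for 1, \<open>False\<close> for 0) taking the dummy value \<open>False\<close>
  outside \<open>{1..n}\<close>. The vector with \<open>i\<close>-th coordinate \<open>t\<close> and the other coordinates
  those of \<open>w\<close> is \<open>w(i := t)\<close>.
\<close>

definition assignments :: "nat \<Rightarrow> (nat \<Rightarrow> bool) set" where
  "assignments n = PiE_dflt {1..n} False (\<lambda>_. UNIV)"

definition RCT :: "nat \<Rightarrow> real \<Rightarrow> (nat \<Rightarrow> bool) pmf" where
  "RCT n p = Pi_pmf {1..n} False (\<lambda>_. bernoulli_pmf p)"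

text \<open>
  For \<open>0 < p < 1\<close> the support of \<open>RCT n p\<close> is all of \<open>assignments n\<close>, so the conditional
  law below is the genuine one for every \<open>x\<close> in \<open>d i ` assignments n\<close>; for other \<open>x\<close>
  (an event of probability 0) \<open>h_star\<close> is unspecified.
\<close>

definition h_star ::
  "nat \<Rightarrow> (nat \<Rightarrow> (nat \<Rightarrow> bool) \<Rightarrow> real) \<Rightarrow> (nat \<Rightarrow> (nat \<Rightarrow> bool) \<Rightarrow> 'd) \<Rightarrow> nat \<Rightarrow> 'd \<Rightarrow> real \<Rightarrow> real"
  where
  "h_star n y d i x p = measure_pmf.expectation (cond_pmf (RCT n p) {w. d i w = x}) (y i)"

definition y_tilde ::
  "nat \<Rightarrow> (nat \<Rightarrow> (nat \<Rightarrow> bool) \<Rightarrow> real) \<Rightarrow> (nat \<Rightarrow> (nat \<Rightarrow> bool) \<Rightarrow> 'd) \<Rightarrow>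
    nat \<Rightarrow> (nat \<Rightarrow> bool) \<Rightarrow> real \<Rightarrow> real"
  where
  "y_tilde n y d i w p = h_star n y d i (d i w) p"

definition policy_mean ::
  "nat \<Rightarrow> (nat \<Rightarrow> (nat \<Rightarrow> bool) \<Rightarrow> real) \<Rightarrow> (nat \<Rightarrow> (nat \<Rightarrow> bool) \<Rightarrow> 'd) \<Rightarrow> real \<Rightarrow> real \<Rightarrow> real"
  where
  "policy_mean n y d p1 p2 =
    1 / real n * (\<Sum>i=1..n. measure_pmf.expectation (RCT n p1) (\<lambda>w. h_star n y d i (d i w) p2))"

text \<open>
  Only the treatment probability \<open>p1\<close> of the first argument is varied; the pseudo-true
  outcome model stays at \<open>p\<close>. For \<open>0 < p < 1\<close> the map is polynomial in \<open>p1\<close> near \<open>p\<close>, so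
  \<open>deriv\<close> is an actual derivative there.
\<close>

definition tau_MPE ::
  "nat \<Rightarrow> (nat \<Rightarrow> (nat \<Rightarrow> bool) \<Rightarrow> real) \<Rightarrow> (nat \<Rightarrow> (nat \<Rightarrow> bool) \<Rightarrow> 'd) \<Rightarrow> real \<Rightarrow> real"
  where
  "tau_MPE n y d p = deriv (\<lambda>p1. policy_mean n y d p1 p) p"

definition tau_ADE ::
  "nat \<Rightarrow> (nat \<Rightarrow> (nat \<Rightarrow> bool) \<Rightarrow> real) \<Rightarrow> (nat \<Rightarrow> (nat \<Rightarrow> bool) \<Rightarrow> 'd) \<Rightarrow> real \<Rightarrow> real"
  where
  "tau_ADE n y d p =
    1 / real n * (\<Sum>i=1..n. measure_pmf.expectation (RCT n p)
      (\<lambda>w. y_tilde n y d i (w(i := True)) p - y_tilde n y d i (w(i := False)) p))"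

definition tau_AIE ::
  "nat \<Rightarrow> (nat \<Rightarrow> (nat \<Rightarrow> bool) \<Rightarrow> real) \<Rightarrow> (nat \<Rightarrow> (nat \<Rightarrow> bool) \<Rightarrow> 'd) \<Rightarrow> real \<Rightarrow> real"
  where
  "tau_AIE n y d p =
    1 / real n * (\<Sum>j=1..n. \<Sum>i\<in>{1..n} - {j}. measure_pmf.expectation (RCT n p)
      (\<lambda>w. y_tilde n y d j (w(i := True)) p - y_tilde n y d j (w(i := False)) p))"

end

theory Submission
  imports Defs
begin

text \<open>
  This is the Margulis--Russo formula: the expectation of any function of independent
  Bernoulli variables is affine in each marginal probability separately, with slope the
  expected discrete derivative in that coordinate, so moving all probabilities together
  yields the sum of these slopes. Applied to the pseudo-true outcome of unit \<open>i\<close>, the slope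
  in coordinate \<open>i\<close> is the direct effect and the others are indirect effects.
\<close>

lemma finite_set_Pi_bernoulli_pmf:
  assumes "finite A"
  shows "finite (set_pmf (Pi_pmf A b (\<lambda>_. bernoulli_pmf p)))"
  using assms by (intro finite_subset[OF set_Pi_pmf_subset'] finite_PiE_dflt) auto

lemma integrable_Pi_bernoulli_pmf:
  fixes f :: "('a \<Rightarrow> bool) \<Rightarrow> real"
  assumes "finite A"
  shows "integrable (measure_pmf (Pi_pmf A b (\<lambda>_. bernoulli_pmf p))) f"
  using finite_set_Pi_bernoulli_pmf[OF assms] by (rule integrable_measure_pmf_finite)

text \<open>Conditioning on coordinate \<open>x\<close>, which is independent of the others; the
  bounds on \<open>p\<close> make the two weights exactly \<open>p\<close> and
  \<open>1 - p\<close>.\<close>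

lemma expectation_Pi_bernoulli_pmf_insert:
  fixes f :: "('a \<Rightarrow> bool) \<Rightarrow> real"
  assumes "finite A" "x \<notin> A" "0 \<le> p" "p \<le> 1"
  shows "measure_pmf.expectation (Pi_pmf (insert x A) b (\<lambda>_. bernoulli_pmf p)) f =
    p * measure_pmf.expectation (Pi_pmf A b (\<lambda>_. bernoulli_pmf p)) (\<lambda>w. f (w(x := True))) +
    (1 - p) * measure_pmf.expectation (Pi_pmf A b (\<lambda>_. bernoulli_pmf p)) (\<lambda>w. f (w(x := False)))"
proof -
  have "measure_pmf.expectation (Pi_pmf (insert x A) b (\<lambda>_. bernoulli_pmf p)) f =
    measure_pmf.expectation (bernoulli_pmf p \<bind>
      (\<lambda>t. map_pmf (\<lambda>w. w(x := t)) (Pi_pmf A b (\<lambda>_. bernoulli_pmf p)))) f"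
    using assms by (simp add: Pi_pmf_insert' map_pmf_def)
  also have "\<dots> = (\<Sum>t\<in>UNIV. pmf (bernoulli_pmf p) t *\<^sub>R
      measure_pmf.expectation (map_pmf (\<lambda>w. w(x := t)) (Pi_pmf A b (\<lambda>_. bernoulli_pmf p))) f)"
    using assms(1) by (intro pmf_expectation_bind) (auto simp: finite_set_Pi_bernoulli_pmf)
  finally show ?thesis
    using assms by (simp add: UNIV_bool)
qed

text \<open>Induction on \<open>A\<close> for all \<open>f\<close> at once, since the step needs
  both sections of \<open>f\<close> at the new coordinate \<open>x\<close>. By the product rule,
  differentiating the weights gives the slope in \<open>x\<close>, differentiating the expectations
  gives the slopes in \<open>A\<close>.\<close>

theorem Margulis_Russo:
  fixes f :: "('a \<Rightarrow> bool) \<Rightarrow> real"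
  assumes "finite A" "0 < p" "p < 1"
  shows "((\<lambda>q. measure_pmf.expectation (Pi_pmf A b (\<lambda>_. bernoulli_pmf q)) f) has_real_derivative
    (\<Sum>i\<in>A. measure_pmf.expectation (Pi_pmf A b (\<lambda>_. bernoulli_pmf p))
      (\<lambda>w. f (w(i := True)) - f (w(i := False))))) (at p)"
  using assms(1)
proof (induction A arbitrary: f rule: finite_induct)
  case empty
  then show ?case by simp
next
  case (insert x A)
  let ?E = "\<lambda>q. measure_pmf.expectation (Pi_pmf A b (\<lambda>_. bernoulli_pmf q))"
  let ?E' = "\<lambda>q. measure_pmf.expectation (Pi_pmf (insert x A) b (\<lambda>_. bernoulli_pmf q))"
  let ?D = "\<lambda>i f w. f (w(i := True)) - f (w(i := False)) :: real"
  let ?f = "\<lambda>t w. f (w(x := t))"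
  note E' = expectation_Pi_bernoulli_pmf_insert[OF insert.hyps]
  \<comment> \<open>The updates inside \<open>?D x f\<close> overwrite coordinate \<open>x\<close>,
    so both sections agree and the weights add up to 1.\<close>
  have "?E' p (?D x f) = ?E p (?f True) - ?E p (?f False)"
    using assms insert.hyps
    by (simp add: E' integrable_Pi_bernoulli_pmf algebra_simps)
  moreover have "(\<Sum>i\<in>A. ?E' p (?D i f)) =
      (\<Sum>i\<in>A. p * ?E p (?D i (?f True)) + (1 - p) * ?E p (?D i (?f False)))"
  proof (rule sum.cong[OF refl])
    fix i assume "i \<in> A"
    then have "i \<noteq> x" using insert.hyps by auto
    then show "?E' p (?D i f) = p * ?E p (?D i (?f True)) + (1 - p) * ?E p (?D i (?f False))"
      using assms by (simp add: E' fun_upd_twist)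
  qed
  ultimately have sum: "(\<Sum>i\<in>insert x A. ?E' p (?D i f)) = ?E p (?f True) - ?E p (?f False) +
      (p * (\<Sum>i\<in>A. ?E p (?D i (?f True))) + (1 - p) * (\<Sum>i\<in>A. ?E p (?D i (?f False))))"
    by (simp only: sum.insert[OF insert.hyps] sum.distrib sum_distrib_left)
  have "((\<lambda>q. q * ?E q (?f True) + (1 - q) * ?E q (?f False)) has_real_derivative
      (\<Sum>i\<in>insert x A. ?E' p (?D i f))) (at p)"
    unfolding sum
    by (rule derivative_eq_intros insert.IH[of "?f True"] insert.IH[of "?f False"] refl)+
      (simp only: mult.commute mult_1 mult_minus_left add_0 diff_0 diff_conv_add_uminus add_ac)
  \<comment> \<open>The splitting is available only for \<open>q\<close> in [0,1]; since
    \<open>p\<close> is interior, agreement on the open unit interval is enough.\<close>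
  then show ?case
    by (rule has_field_derivative_transform_within_open[where S = "{0<..<1}"])
      (use assms in \<open>auto simp: E'\<close>)
qed

theorem theorem2p2:
  fixes n :: nat
    and p :: real
    and y :: "nat \<Rightarrow> (nat \<Rightarrow> bool) \<Rightarrow> real"
    and d :: "nat \<Rightarrow> (nat \<Rightarrow> bool) \<Rightarrow> 'd"
    and D :: "nat \<Rightarrow> 'd set"
  assumes "n \<ge> 1"
    and "0 < p" and "p < 1"
    and "\<And>i. i \<in> {1..n} \<Longrightarrow> d i \<in> assignments n \<rightarrow> D i"
  shows "tau_MPE n y d p = tau_ADE n y d p + tau_AIE n y d p"
proof -
  let ?\<delta> = "\<lambda>j i. measure_pmf.expectation (RCT n p)
    (\<lambda>w. y_tilde n y d j (w(i := True)) p - y_tilde n y d j (w(i := False)) p)"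
  \<comment> \<open>The outcome model stays frozen at \<open>p\<close> while the design varies with
    \<open>q\<close>, so the integrand is one fixed function of \<open>w\<close>.\<close>
  have "((\<lambda>q. measure_pmf.expectation (RCT n q) (\<lambda>w. y_tilde n y d j w p)) has_real_derivative
      (\<Sum>i=1..n. ?\<delta> j i)) (at p)" for j
    unfolding RCT_def using assms by (intro Margulis_Russo) auto
  then have "((\<lambda>q. policy_mean n y d q p) has_real_derivative
      1 / real n * (\<Sum>j=1..n. \<Sum>i=1..n. ?\<delta> j i)) (at p)"
    unfolding policy_mean_def y_tilde_def by (intro DERIV_cmult DERIV_sum)
  then have "tau_MPE n y d p = 1 / real n * (\<Sum>j=1..n. \<Sum>i=1..n. ?\<delta> j i)"
    unfolding tau_MPE_def by (rule DERIV_imp_deriv)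
  \<comment> \<open>The diagonal \<open>i = j\<close> carries the direct effects, the rest of row
    \<open>j\<close> the spillovers onto unit \<open>j\<close>.\<close>
  also have "(\<Sum>j=1..n. \<Sum>i=1..n. ?\<delta> j i) = (\<Sum>j=1..n. ?\<delta> j j + (\<Sum>i\<in>{1..n} - {j}. ?\<delta> j i))"
    by (intro sum.cong refl sum.remove) auto
  finally show ?thesis
    by (simp add: tau_ADE_def tau_AIE_def sum.distrib distrib_left)
qed

end
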